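(* Let $X$ be a convex subset of a real vector space and let $\succcurlyeq$ be a convex, complete and transitive binary relation on $X$. Then the following properties of $\succcurlyeq$ are equivalent: Archimedean; strict-Archimedean; mixture-continuous; weakly Wold-continuous.
   Context: For a binary relation $\succcurlyeq$ on $X$: $x\succ y$ iff $x\succcurlyeq y$ and not $y\succcurlyeq x$; $x\sim y$ iff $x\succcurlyeq y$ and $y\succcurlyeq x$; $x\preccurlyeq y$ iff $y\succcurlyeq x$; $x\prec y$ iff $y\succ x$. Complete: $x\succcurlyeq y$ or $y\succcurlyeq x$ for all $x,y\in X$. Convex: $\{y\in X: y\succcurlyeq x\}$ is convex for all $x\in X$. For $\lambda\in[0,1]$, $x\lambda y=\lambda x+(1-\lambda)y$. Archimedean: for all $x,y,z\in X$ with $x\succ y$ there exist $\lambda,\delta\in(0,1)$ with $x\lambda z\succ y$ and $x\succ y\delta z$. Strict-Archimedean: for all $x,y,z\in X$, $\{\lambda\in[0,1]: x\lambda y\succ z\}$ and $\{\lambda\in[0,1]: x\lambda y\prec z\}$ are open in $[0,1]$. Mixture-continuous: for all $x,y,z\in X$, $\{\lambda\in[0,1]: x\lambda y\succcurlyeq z\}$ and $\{\lambda\in[0,1]: x\lambda y\preccurlyeq z\}$ are closed. Weakly Wold-continuous: (i) (order dense) $x\succ y$ implies that there exists $z\in X$ with $x\succ z\succ y$; and (ii) $x\succ z\succ y$ implies that the straight line segment joining $x$ to $y$ contains a point $w$ with $w\sim z$. *)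

theory Defs
  imports "HOL-Analysis.Analysis"
begin

text \<open>
  A binary relation on a set \<open>X\<close> is a predicate \<open>R\<close> of which only the values on \<open>X\<close> matter;
  \<open>R x y\<close> stands for "\<open>x\<close> is weakly preferred to \<open>y\<close>".
\<close>

definition strictly :: "('a \<Rightarrow> 'a \<Rightarrow> bool) \<Rightarrow> 'a \<Rightarrow> 'a \<Rightarrow> bool" where
  "strictly R x y \<longleftrightarrow> R x y \<and> \<not> R y x"

definition indifferent :: "('a \<Rightarrow> 'a \<Rightarrow> bool) \<Rightarrow> 'a \<Rightarrow> 'a \<Rightarrow> bool" where
  "indifferent R x y \<longleftrightarrow> R x y \<and> R y x"

text \<open>Unlike \<^const>\<open>totalp_on\<close>, completeness includes reflexivity on \<open>X\<close>.\<close>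

definition complete_rel_on :: "'a set \<Rightarrow> ('a \<Rightarrow> 'a \<Rightarrow> bool) \<Rightarrow> bool" where
  "complete_rel_on X R \<longleftrightarrow> (\<forall>x\<in>X. \<forall>y\<in>X. R x y \<or> R y x)"

definition convex_rel_on :: "'a::real_vector set \<Rightarrow> ('a \<Rightarrow> 'a \<Rightarrow> bool) \<Rightarrow> bool" where
  "convex_rel_on X R \<longleftrightarrow> (\<forall>x\<in>X. convex {y \<in> X. R y x})"

text \<open>The first point \<open>x\<close> carries the weight \<open>l\<close>.\<close>

definition mix :: "'a::real_vector \<Rightarrow> real \<Rightarrow> 'a \<Rightarrow> 'a" where
  "mix x l y = l *\<^sub>R x + (1 - l) *\<^sub>R y"

definition archimedean_on :: "'a::real_vector set \<Rightarrow> ('a \<Rightarrow> 'a \<Rightarrow> bool) \<Rightarrow> bool" where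
  "archimedean_on X R \<longleftrightarrow>
     (\<forall>x\<in>X. \<forall>y\<in>X. \<forall>z\<in>X. strictly R x y \<longrightarrow>
        (\<exists>l\<in>{0<..<1}. \<exists>d\<in>{0<..<1}. strictly R (mix x l z) y \<and> strictly R x (mix y d z)))"

definition strict_archimedean_on :: "'a::real_vector set \<Rightarrow> ('a \<Rightarrow> 'a \<Rightarrow> bool) \<Rightarrow> bool" where
  "strict_archimedean_on X R \<longleftrightarrow>
     (\<forall>x\<in>X. \<forall>y\<in>X. \<forall>z\<in>X.
        openin (top_of_set {0..1}) {l \<in> {0..1}. strictly R (mix x l y) z} \<and>
        openin (top_of_set {0..1}) {l \<in> {0..1}. strictly R z (mix x l y)})"

definition mixture_continuous_on :: "'a::real_vector set \<Rightarrow> ('a \<Rightarrow> 'a \<Rightarrow> bool) \<Rightarrow> bool" where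
  "mixture_continuous_on X R \<longleftrightarrow>
     (\<forall>x\<in>X. \<forall>y\<in>X. \<forall>z\<in>X.
        closed {l \<in> {0..1}. R (mix x l y) z} \<and>
        closed {l \<in> {0..1}. R z (mix x l y)})"

definition order_dense_on :: "'a set \<Rightarrow> ('a \<Rightarrow> 'a \<Rightarrow> bool) \<Rightarrow> bool" where
  "order_dense_on X R \<longleftrightarrow>
     (\<forall>x\<in>X. \<forall>y\<in>X. strictly R x y \<longrightarrow> (\<exists>z\<in>X. strictly R x z \<and> strictly R z y))"

definition weakly_wold_continuous_on :: "'a::real_vector set \<Rightarrow> ('a \<Rightarrow> 'a \<Rightarrow> bool) \<Rightarrow> bool" where
  "weakly_wold_continuous_on X R \<longleftrightarrow>
     order_dense_on X R \<and>
     (\<forall>x\<in>X. \<forall>y\<in>X. \<forall>z\<in>X. strictly R x z \<and> strictly R z y \<longrightarrow>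
        (\<exists>w\<in>closed_segment x y. indifferent R w z))"

end

theory Submission
  imports Defs
begin

text \<open>
  The Archimedean property says that the strict upper and lower contour sets, restricted to a
  segment, are radially open. On a segment the weak upper contour sets are intervals, and a
  radially open interval is open, as is the complement of an interval if it is radially open.
  Hence the Archimedean property implies the strict one, which by completeness is
  mixture-continuity. Connectedness of \<open>[0,1]\<close> then yields the two Wold conditions. Conversely, an
  intermediate indifference level, provided by order density, is attained on every segment
  which crosses it, so the better end and the worse end can both be moved a little.
\<close>

section \<open>Mixtures along a segment\<close>

lemma mix_mix: "mix (mix x l y) t (mix x m y) = mix x (mix l t m) y"
  unfolding mix_def by (simp add: algebra_simps)

lemma mix_one [simp]: "mix x 1 y = x" and mix_zero [simp]: "mix x 0 y = y"
  by (simp_all add: mix_def)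

lemma mix_mem_convex:
  assumes "convex S" "x \<in> S" "y \<in> S" "l \<in> {0..1}"
  shows "mix x l y \<in> S"
  using assms unfolding mix_def by (auto intro!: convexD)

lemma closed_segment_mixE:
  assumes "w \<in> closed_segment x y"
  obtains l where "l \<in> {0..1}" "w = mix x l y"
proof -
  from assms have "w \<in> closed_segment y x"
    by (simp add: closed_segment_commute)
  then obtain l where "0 \<le> l" "l \<le> 1" "w = (1 - l) *\<^sub>R y + l *\<^sub>R x"
    unfolding in_segment by blast
  then show thesis
    by (intro that[of l]) (auto simp: mix_def add.commute)
qed

text \<open>By \<open>mix_mix\<close> the map from a weight to its mixture is affine, so preimages
  of convex sets are convex. This turns contour sets in \<open>X\<close> into intervals of
  weights.\<close>

lemma convex_mix_vimage:
  assumes "convex S"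
  shows "convex {l \<in> {0..1}. mix x l y \<in> S}"
proof (rule convexI)
  fix a b u v :: real
  assume a: "a \<in> {l \<in> {0..1}. mix x l y \<in> S}" and b: "b \<in> {l \<in> {0..1}. mix x l y \<in> S}"
    and uv: "0 \<le> u" "0 \<le> v" "u + v = 1"
  have eq: "u *\<^sub>R a + v *\<^sub>R b = mix a u b"
    using uv by (simp add: mix_def eq_diff_eq add.commute)
  have "mix a u b \<in> {0..1}"
    using a b uv by (intro mix_mem_convex) auto
  moreover have "mix x (mix a u b) y \<in> S"
    using a b uv mix_mem_convex[OF assms, of "mix x a y" "mix x b y" u] by (simp add: mix_mix)
  ultimately show "u *\<^sub>R a + v *\<^sub>R b \<in> {l \<in> {0..1}. mix x l y \<in> S}"
    unfolding eq by simp
qed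

section \<open>From radial openness to topology\<close>

text \<open>Moving from a point of \<open>S\<close> towards 0 and towards 1 gives points of
  \<open>S\<close> on both sides of it, and the interval \<open>S\<close> contains everything
  between them.\<close>

lemma openin_unit_interval_if_radially_open:
  fixes S :: "real set"
  assumes S: "convex S" "S \<subseteq> {0..1}"
    and radial: "\<And>a b. a \<in> S \<Longrightarrow> b \<in> {0..1} \<Longrightarrow> \<exists>t\<in>{0<..<1}. mix a t b \<in> S"
  shows "openin (top_of_set {0..1}) S"
  unfolding openin_subopen[of _ S]
proof
  fix a assume a: "a \<in> S"
  obtain s where s: "s \<in> {0<..<1}" "mix a s 0 \<in> S"
    using radial[OF a, of 0] by auto
  obtain t where t: "t \<in> {0<..<1}" "mix a t 1 \<in> S"
    using radial[OF a, of 1] by auto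
  \<comment> \<open>At an endpoint of the unit interval there is nothing to move towards; any bound
    outside \<open>{0..1}\<close> then serves, because the neighbourhood is intersected with
    \<open>{0..1}\<close>.\<close>
  define p where "p = (if a = 0 then -1 else mix a s 0)"
  define q where "q = (if a = 1 then 2 else mix a t 1)"
  have a01: "0 \<le> a" "a \<le> 1" using a S by auto
  have "p < a"
    using a01 s by (auto simp: p_def mix_def)
  moreover have "a < q"
  proof (cases "a = 1")
    case False
    then have "0 < (1 - t) * (1 - a)" using a01 t by (intro mult_pos_pos) auto
    then show ?thesis using False by (simp add: q_def mix_def algebra_simps)
  qed (simp add: q_def)
  moreover have "{0..1} \<inter> {p<..<q} \<subseteq> S"
  proof
    fix c assume c: "c \<in> {0..1} \<inter> {p<..<q}"
    have iv: "is_interval S" using S by (simp add: is_interval_convex_1)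
    show "c \<in> S"
    proof (cases "c \<le> a")
      case True
      have "mix a s 0 \<le> c" using c by (cases "a = 0") (auto simp: p_def mix_def)
      then show ?thesis using True iv s a unfolding is_interval_1 by blast
    next
      case False
      have "c \<le> mix a t 1" using c by (cases "a = 1") (auto simp: q_def mix_def)
      then show ?thesis using False iv t a unfolding is_interval_1 by (meson linear)
    qed
  qed
  ultimately show "\<exists>T. openin (top_of_set {0..1}) T \<and> a \<in> T \<and> T \<subseteq> S"
    using a01 by (intro exI[of _ "{0..1} \<inter> {p<..<q}"]) auto
qed

text \<open>Suppose \<open>a\<close> lies in the closure of \<open>C\<close> but not in
  \<open>C\<close>. Moving it slightly towards a relative interior point \<open>b\<close> would stay
  outside \<open>C\<close>, yet the open segment from \<open>b\<close> to \<open>a\<close> lies in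
  the relative interior of \<open>C\<close>.\<close>

lemma closed_if_complement_radially_open:
  fixes C :: "'a::euclidean_space set"
  assumes "closed K" "convex C" "C \<subseteq> K"
    and radial: "\<And>a b. a \<in> K - C \<Longrightarrow> b \<in> K \<Longrightarrow> \<exists>t\<in>{0<..<1}. mix a t b \<in> K - C"
  shows "closed C"
proof -
  have "closure C \<subseteq> C"
  proof
    fix a assume a: "a \<in> closure C"
    then obtain b where b: "b \<in> rel_interior C"
      using assms(2) by (metis closure_empty empty_iff ex_in_conv rel_interior_eq_empty)
    have bC: "b \<in> C" using b rel_interior_subset by blast
    show "a \<in> C"
    proof (rule ccontr)
      assume n: "a \<notin> C"
      have "a \<in> K" using a assms closure_minimal by blast
      then obtain t where t: "t \<in> {0<..<1}" "mix a t b \<notin> C"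
        using radial[of a b] n bC assms(3) by blast
      have "a \<noteq> b" using n bC by blast
      then have "mix a t b \<in> open_segment b a"
        using t(1) unfolding in_segment mix_def by (auto simp: add.commute)
      then show False
        using rel_interior_closure_convex_segment[OF assms(2) b a] t(2) rel_interior_subset by blast
    qed
  qed
  then show ?thesis by (simp add: closure_subset_eq)
qed

section \<open>Convex, complete and transitive relations\<close>

locale convex_weak_order =
  fixes X :: "'a::real_vector set" and R :: "'a \<Rightarrow> 'a \<Rightarrow> bool"
  assumes convex_X: "convex X"
    and convex_R: "convex_rel_on X R"
    and complete_R: "complete_rel_on X R"
    and trans_R: "transp_on X R"
begin

lemma trans: "R x y \<Longrightarrow> R y z \<Longrightarrow> x \<in> X \<Longrightarrow> y \<in> X \<Longrightarrow> z \<in> X \<Longrightarrow> R x z"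
  using trans_R by (meson transp_onD)

lemma total: "x \<in> X \<Longrightarrow> y \<in> X \<Longrightarrow> R x y \<or> R y x"
  using complete_R by (simp add: complete_rel_on_def)

lemma strictly_iff: "x \<in> X \<Longrightarrow> y \<in> X \<Longrightarrow> strictly R x y \<longleftrightarrow> \<not> R y x"
  unfolding strictly_def using total by blast

lemma strictly_trans1: "R x y \<Longrightarrow> strictly R y z \<Longrightarrow> x \<in> X \<Longrightarrow> y \<in> X \<Longrightarrow> z \<in> X \<Longrightarrow> strictly R x z"
  and strictly_trans2: "strictly R x y \<Longrightarrow> R y z \<Longrightarrow> x \<in> X \<Longrightarrow> y \<in> X \<Longrightarrow> z \<in> X \<Longrightarrow> strictly R x z"
  unfolding strictly_def by (meson trans)+

lemma mix_mem: "x \<in> X \<Longrightarrow> y \<in> X \<Longrightarrow> l \<in> {0..1} \<Longrightarrow> mix x l y \<in> X"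
  using mix_mem_convex convex_X by blast

lemma convex_upper: "x \<in> X \<Longrightarrow> convex {y \<in> X. R y x}"
  using convex_R by (simp add: convex_rel_on_def)

text \<open>A mixture of two points is weakly preferred to the worse of them, since the weak upper
  contour set of the worse one is convex and contains both. Strict preference over \<open>z\<close>
  is then inherited.\<close>

lemma convex_strict_upper:
  assumes "z \<in> X"
  shows "convex {y \<in> X. strictly R y z}"
proof (rule convexI)
  fix a b and u v :: real
  assume a: "a \<in> {y \<in> X. strictly R y z}" and b: "b \<in> {y \<in> X. strictly R y z}"
    and uv: "0 \<le> u" "0 \<le> v" "u + v = 1"
  let ?m = "u *\<^sub>R a + v *\<^sub>R b"
  have m: "?m \<in> X" using a b uv convex_X by (auto intro: convexD)
  have "\<exists>c\<in>{a, b}. R ?m c"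
  proof (cases "R a b")
    case True
    then have "?m \<in> {y \<in> X. R y b}"
      using a b uv total[of b b] by (intro convexD[OF convex_upper]) auto
    then show ?thesis by auto
  next
    case False
    then have "?m \<in> {y \<in> X. R y a}"
      using a b uv total[of a a] total[of a b] by (intro convexD[OF convex_upper]) auto
    then show ?thesis by auto
  qed
  then obtain c where "c \<in> {a, b}" "R ?m c" by blast
  moreover from this have "c \<in> X" "strictly R c z" using a b by auto
  ultimately show "?m \<in> {y \<in> X. strictly R y z}"
    using m assms strictly_trans1[of ?m c z] by simp
qed

section \<open>The implications between the four properties\<close>

text \<open>Completeness makes each strict set the complement in \<open>{0..1}\<close> of a weak set
  for the reversed comparison, and \<open>{0..1}\<close> is itself closed.\<close>

lemma strict_archimedean_iff_mixture_continuous: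
  "strict_archimedean_on X R \<longleftrightarrow> mixture_continuous_on X R"
proof -
  have compl: "openin (top_of_set {0..1::real}) A \<longleftrightarrow> closed B"
    if "A = {0..1} - B" "B \<subseteq> {0..1}" for A B
    using that by (simp add: openin_closedin_eq closedin_closed_eq double_diff)
  have "openin (top_of_set {0..1}) {l \<in> {0..1}. strictly R (mix x l y) z} \<longleftrightarrow>
        closed {l \<in> {0..1}. R z (mix x l y)}"
    "openin (top_of_set {0..1}) {l \<in> {0..1}. strictly R z (mix x l y)} \<longleftrightarrow>
        closed {l \<in> {0..1}. R (mix x l y) z}"
    if "x \<in> X" "y \<in> X" "z \<in> X" for x y z
    by (rule compl; use that mix_mem in \<open>auto simp: strictly_iff\<close>)+
  then show ?thesis
    unfolding strict_archimedean_on_def mixture_continuous_on_def by blast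
qed

lemma archimedean_imp_strict_archimedean:
  assumes A: "archimedean_on X R"
  shows "strict_archimedean_on X R"
  unfolding strict_archimedean_on_def
proof (intro ballI conjI)
  fix x y z assume X: "x \<in> X" "y \<in> X" "z \<in> X"
  let ?U = "{l \<in> {0..1}. strictly R (mix x l y) z}"
  let ?C = "{l \<in> {0..1}. R (mix x l y) z}"
  have arch: "(\<exists>l\<in>{0<..<1}. strictly R (mix u l w) v) \<and> (\<exists>l\<in>{0<..<1}. strictly R u (mix v l w))"
    if "strictly R u v" "u \<in> X" "v \<in> X" "w \<in> X" for u v w
    using A that unfolding archimedean_on_def by blast
  have U: "?U = {l \<in> {0..1}. mix x l y \<in> {y \<in> X. strictly R y z}}"
    and C: "?C = {l \<in> {0..1}. mix x l y \<in> {y \<in> X. R y z}}"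
    using X mix_mem by auto
  show "openin (top_of_set {0..1}) ?U"
  proof (rule openin_unit_interval_if_radially_open)
    show "convex ?U"
      unfolding U using X by (intro convex_mix_vimage convex_strict_upper)
    fix a b :: real assume ab: "a \<in> ?U" "b \<in> {0..1}"
    then obtain t where t: "t \<in> {0<..<1}" "strictly R (mix (mix x a y) t (mix x b y)) z"
      using arch[of "mix x a y" z "mix x b y"] X mix_mem by auto
    moreover have "mix a t b \<in> {0..1}"
      using ab t by (intro mix_mem_convex) auto
    ultimately show "\<exists>t\<in>{0<..<1}. mix a t b \<in> ?U"
      unfolding mix_mix by blast
  qed auto
  \<comment> \<open>The strict lower set need not be an interval: it may have a piece at each end.
    Its complement \<open>?C\<close> is one, so closedness of \<open>?C\<close> is shown
    instead.\<close>
  have L: "{l \<in> {0..1}. strictly R z (mix x l y)} = {0..1} - ?C"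
    using X mix_mem by (auto simp: strictly_iff)
  have "closed ?C"
  proof (rule closed_if_complement_radially_open)
    show "convex ?C"
      unfolding C using X by (intro convex_mix_vimage convex_upper)
    fix a b :: real assume ab: "a \<in> {0..1} - ?C" "b \<in> {0..1}"
    then have "strictly R z (mix x a y)"
      using X mix_mem by (auto simp: strictly_iff)
    then obtain t where t: "t \<in> {0<..<1}" "strictly R z (mix (mix x a y) t (mix x b y))"
      using arch[of z "mix x a y" "mix x b y"] ab X mix_mem by auto
    moreover have "mix a t b \<in> {0..1}"
      using ab t by (intro mix_mem_convex) auto
    ultimately show "\<exists>t\<in>{0<..<1}. mix a t b \<in> {0..1} - ?C"
      unfolding mix_mix L[symmetric] by blast
  qed auto
  then show "openin (top_of_set {0..1}) {l \<in> {0..1}. strictly R z (mix x l y)}"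
    unfolding L Diff_eq by (intro openin_open_Int open_Compl)
qed

lemma mixture_continuous_imp_weakly_wold:
  assumes M: "mixture_continuous_on X R"
  shows "weakly_wold_continuous_on X R"
proof -
  \<comment> \<open>Connectedness of the unit interval, in the form used for both Wold
    conditions.\<close>
  have meet: "A \<inter> B \<inter> {0..1} \<noteq> {}"
    if "closed A" "closed B" "{0..1} \<subseteq> A \<union> B" "1 \<in> A" "0 \<in> B" for A B :: "real set"
  proof
    assume "A \<inter> B \<inter> {0..1} = {}"
    then have "A \<inter> {0..1} = {} \<or> B \<inter> {0..1} = {}"
      using that by (intro connected_closedD) auto
    moreover have "(0::real) \<in> {0..1}" "(1::real) \<in> {0..1}" by auto
    ultimately show False using that by blast
  qed
  have "\<exists>z\<in>X. strictly R x z \<and> strictly R z y"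
    if X: "x \<in> X" "y \<in> X" and xy: "strictly R x y" for x y
  proof (rule ccontr)
    assume none: "\<not> ?thesis"
    \<comment> \<open>Without an intermediate point, every mixture is weakly above \<open>x\<close>
      or weakly below \<open>y\<close>; both at once would give \<open>R y x\<close>. So two
      disjoint closed sets would cover the unit interval, one containing 1 and the other 0.\<close>
    let ?A = "{l \<in> {0..1}. R (mix x l y) x}" and ?B = "{l \<in> {0..1}. R y (mix x l y)}"
    have "closed ?A" "closed ?B"
      using M X unfolding mixture_continuous_on_def by blast+
    moreover have "{0..1} \<subseteq> ?A \<union> ?B"
      using none X mix_mem by (auto simp: strictly_iff)
    moreover have "?A \<inter> ?B \<inter> {0..1} = {}"
      using xy X mix_mem trans unfolding strictly_def by blast
    moreover have "1 \<in> ?A" "0 \<in> ?B"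
      using X total by auto
    ultimately show False
      using meet[of ?A ?B] by argo
  qed
  moreover have "\<exists>w\<in>closed_segment x y. indifferent R w z"
    if X: "x \<in> X" "y \<in> X" "z \<in> X" and xz: "strictly R x z" and zy: "strictly R z y" for x y z
  proof -
    let ?A = "{l \<in> {0..1}. R (mix x l y) z}" and ?B = "{l \<in> {0..1}. R z (mix x l y)}"
    have "closed ?A" "closed ?B"
      using M X unfolding mixture_continuous_on_def by blast+
    moreover have "{0..1} \<subseteq> ?A \<union> ?B"
      using X mix_mem total by blast
    moreover have "1 \<in> ?A" "0 \<in> ?B"
      using xz zy by (auto simp: strictly_def)
    ultimately have "?A \<inter> ?B \<inter> {0..1} \<noteq> {}"
      by (intro meet)
    then obtain l where "l \<in> {0..1}" "indifferent R (mix x l y) z"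
      by (auto simp: indifferent_def)
    moreover from this have "mix x l y \<in> closed_segment x y"
      by (intro mix_mem_convex) auto
    ultimately show ?thesis by blast
  qed
  ultimately show ?thesis
    unfolding weakly_wold_continuous_on_def order_dense_on_def by blast
qed

lemma weakly_wold_imp_archimedean:
  assumes W: "weakly_wold_continuous_on X R"
  shows "archimedean_on X R"
  unfolding archimedean_on_def
proof (intro ballI impI)
  fix x y z assume X: "x \<in> X" "y \<in> X" "z \<in> X" and xy: "strictly R x y"
  have cross: "\<exists>l\<in>{0..1}. indifferent R (mix u l v) w"
    if "strictly R u w" "strictly R w v" "u \<in> X" "v \<in> X" "w \<in> X" for u v w
    using W that closed_segment_mixE unfolding weakly_wold_continuous_on_def by metis
  obtain w where w: "w \<in> X" "strictly R x w" "strictly R w y"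
    using W X xy unfolding weakly_wold_continuous_on_def order_dense_on_def by blast
  have "\<exists>l\<in>{0<..<1}. strictly R (mix x l z) y"
  proof (cases "strictly R z y")
    case True
    then have "mix x (1/2) z \<in> {u \<in> X. strictly R u y}"
      using X xy by (intro mix_mem_convex convex_strict_upper) auto
    then show ?thesis by (intro bexI[of _ "1/2"]) auto
  next
    case False
    \<comment> \<open>Here \<open>z\<close> is weakly below \<open>y\<close>, so the segment from
      \<open>x\<close> to \<open>z\<close> crosses the level of \<open>w\<close>, and the crossing
      point is still strictly better than \<open>y\<close>.\<close>
    then have wz: "strictly R w z"
      using w X strictly_iff[of z y] strictly_trans2 by blast
    then obtain l where l: "l \<in> {0..1}" "indifferent R (mix x l z) w"
      using cross w X by blast
    moreover have "l \<noteq> 0" "l \<noteq> 1"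
      using l wz w by (auto simp: indifferent_def strictly_def)
    moreover have "strictly R (mix x l z) y"
      using l w X mix_mem[of x z l] strictly_trans1 unfolding indifferent_def by blast
    ultimately show ?thesis by (intro bexI[of _ l]) auto
  qed
  moreover have "\<exists>d\<in>{0<..<1}. strictly R x (mix y d z)"
  proof (rule ccontr)
    assume "\<not> ?thesis"
    then have up: "R (mix y d z) x" if "d \<in> {0<..<1}" for d
      using that X mix_mem[of y z d] strictly_iff[of x "mix y d z"] by auto
    \<comment> \<open>How \<open>z\<close> compares with \<open>x\<close> is unknown, since
      \<open>up\<close> covers only interior points. The midpoint is one of them, so it lies weakly
      above \<open>x\<close> and the segment from it to \<open>y\<close> crosses the level of
      \<open>w\<close>.\<close>
    let ?q = "mix y (1/2) z"
    have q: "?q \<in> X" "R ?q x"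
      using X up[of "1/2"] mix_mem[of y z "1/2"] by auto
    then have "strictly R ?q w"
      using w X strictly_trans1 by blast
    then obtain l where l: "l \<in> {0..1}" "indifferent R (mix ?q l y) w"
      using cross[of ?q w y] q w X by blast
    have "l \<noteq> 0"
      using l w by (auto simp: indifferent_def strictly_def)
    \<comment> \<open>This number, \<open>1 - l/2\<close>, is the weight of \<open>y\<close> at the
      crossing point. That point is therefore interior to the segment from \<open>y\<close> to
      \<open>z\<close>, so \<open>up\<close> puts it weakly above \<open>x\<close>, although it is
      indifferent to \<open>w\<close>.\<close>
    then have "mix (1/2) l (1::real) \<in> {0<..<1}"
      using l(1) by (auto simp: mix_def)
    moreover have "mix ?q l y = mix y (mix (1/2) l 1) z"
      using mix_mix[of y "1/2" z l 1] by simp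
    ultimately have "R (mix ?q l y) x"
      using up by metis
    then have "R w x"
      using l q w X mix_mem[of ?q y l] trans unfolding indifferent_def by blast
    then show False using w by (simp add: strictly_def)
  qed
  ultimately show "\<exists>l\<in>{0<..<1}. \<exists>d\<in>{0<..<1}. strictly R (mix x l z) y \<and> strictly R x (mix y d z)"
    by blast
qed

end

theorem theorem6:
  fixes X :: "'a::real_vector set" and R :: "'a \<Rightarrow> 'a \<Rightarrow> bool"
  assumes "convex X"
    and "convex_rel_on X R"
    and "complete_rel_on X R"
    and "transp_on X R"
  shows "(archimedean_on X R \<longleftrightarrow> strict_archimedean_on X R) \<and>
         (strict_archimedean_on X R \<longleftrightarrow> mixture_continuous_on X R) \<and>
         (mixture_continuous_on X R \<longleftrightarrow> weakly_wold_continuous_on X R)"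
proof -
  interpret convex_weak_order X R
    using assms by unfold_locales
  show ?thesis
    using archimedean_imp_strict_archimedean strict_archimedean_iff_mixture_continuous
      mixture_continuous_imp_weakly_wold weakly_wold_imp_archimedean by blast
qed

end
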